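(* For every $M>0$ there exists an instance of \textsf{Min-Max-Delay} (a directed graph with non-negative integer edge capacities and delays, a source $s$, a sink $t\neq s$, and a positive integer rate requirement $R$) for which both \textsf{Min-Max-Delay} and \textsf{Int-Min-Max-Delay} are feasible and the integrality gap $\mathcal{D}(f_{\mathsf{IMM}})/\mathcal{D}(f_{\mathsf{MM}})$ is at least $M$. That is, the integrality gap can be arbitrarily large.
   Context: Let $P$ be the set of directed $s$-$t$ paths, $d^p=\sum_{e\in p}d_e$. A flow is $f=\{f^p\ge 0: p\in P\}$; it is feasible if $\sum_{p\in P}f^p=R$ and $\sum_{p\in P: e\in p}f^p\le c_e$ for all edges $e$. Its maximum delay is $\mathcal{D}(f)=\max_{p\in P: f^p>0}d^p$. \textsf{Min-Max-Delay} minimizes $\mathcal{D}(f)$ over feasible flows with real rates; \textsf{Int-Min-Max-Delay} minimizes $\mathcal{D}(f)$ over feasible flows with all $f^p$ non-negative integers. $f_{\mathsf{MM}}$ and $f_{\mathsf{IMM}}$ denote optimal solutions of these two problems respectively, and the integrality gap is $\mathcal{D}(f_{\mathsf{IMM}})/\mathcal{D}(f_{\mathsf{MM}})$. *)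

theory Defs
  imports Complex_Main "Graph_Theory.Graph_Theory"
begin

text \<open>Capacities and delays are arbitrary functions from arcs to naturals and hence carry no
  assumptions here.\<close>

locale min_max_delay_instance = digraph G
  for G :: "('a, 'b) pre_digraph" +
  fixes s :: 'a
    and t :: 'a
    and R :: nat
  assumes source_in_verts: "s \<in> verts G"
    and sink_in_verts: "t \<in> verts G"
    and sink_neq_source: "t \<noteq> s"
    and rate_pos: "R > 0"

text \<open>Paths are simple and represented by their lists of arcs.\<close>

definition st_paths :: "('a, 'b) pre_digraph \<Rightarrow> 'a \<Rightarrow> 'a \<Rightarrow> 'b list set" where
  "st_paths G s t = {p. pre_digraph.apath G s p t}"

definition path_delay :: "('b \<Rightarrow> nat) \<Rightarrow> 'b list \<Rightarrow> nat" where
  "path_delay d p = (\<Sum>e\<in>set p. d e)"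

text \<open>Only the values of a flow on \<^term>\<open>st_paths G s t\<close> are meaningful.\<close>

definition feasible_flow ::
  "('a, 'b) pre_digraph \<Rightarrow> ('b \<Rightarrow> nat) \<Rightarrow> 'a \<Rightarrow> 'a \<Rightarrow> nat \<Rightarrow> ('b list \<Rightarrow> real) \<Rightarrow> bool" where
  "feasible_flow G c s t R f \<longleftrightarrow>
     (\<forall>p \<in> st_paths G s t. 0 \<le> f p) \<and>
     (\<Sum>p \<in> st_paths G s t. f p) = real R \<and>
     (\<forall>e \<in> arcs G. (\<Sum>p \<in> {p \<in> st_paths G s t. e \<in> set p}. f p) \<le> real (c e))"

definition int_feasible_flow ::
  "('a, 'b) pre_digraph \<Rightarrow> ('b \<Rightarrow> nat) \<Rightarrow> 'a \<Rightarrow> 'a \<Rightarrow> nat \<Rightarrow> ('b list \<Rightarrow> real) \<Rightarrow> bool" where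
  "int_feasible_flow G c s t R f \<longleftrightarrow>
     feasible_flow G c s t R f \<and> (\<forall>p \<in> st_paths G s t. f p \<in> \<int>)"

text \<open>For a feasible flow with \<^term>\<open>R > 0\<close> in a finite digraph, the maximum is over a
  finite nonempty set.\<close>

definition max_delay ::
  "('a, 'b) pre_digraph \<Rightarrow> ('b \<Rightarrow> nat) \<Rightarrow> 'a \<Rightarrow> 'a \<Rightarrow> ('b list \<Rightarrow> real) \<Rightarrow> nat" where
  "max_delay G d s t f = Max {path_delay d p | p. p \<in> st_paths G s t \<and> f p > 0}"

definition min_max_delay_optimal ::
  "('a, 'b) pre_digraph \<Rightarrow> ('b \<Rightarrow> nat) \<Rightarrow> ('b \<Rightarrow> nat) \<Rightarrow> 'a \<Rightarrow> 'a \<Rightarrow> nat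
    \<Rightarrow> ('b list \<Rightarrow> real) \<Rightarrow> bool" where
  "min_max_delay_optimal G c d s t R f \<longleftrightarrow>
     is_arg_min (max_delay G d s t) (feasible_flow G c s t R) f"

definition int_min_max_delay_optimal ::
  "('a, 'b) pre_digraph \<Rightarrow> ('b \<Rightarrow> nat) \<Rightarrow> ('b \<Rightarrow> nat) \<Rightarrow> 'a \<Rightarrow> 'a \<Rightarrow> nat
    \<Rightarrow> ('b list \<Rightarrow> real) \<Rightarrow> bool" where
  "int_min_max_delay_optimal G c d s t R f \<longleftrightarrow>
     is_arg_min (max_delay G d s t) (int_feasible_flow G c s t R) f"

end

theory Submission imports Defs "HOL-Library.Nat_Bijection" begin

text \<open>
  The instance is a brick wall with \<^term>\<open>2 * k - 1\<close> columns and unit capacities: column \<open>x\<close>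
  has slots at the heights \<open>y \<le> 2 * k\<close> with \<open>x + y\<close> odd, and a path moves from a slot to one
  of the two slots of the next column at height \<open>y \<plusminus> 1\<close>. Passing through height 1 in an even
  column costs one unit of delay, and so does leaving the source; the rate is \<open>k\<close>.

  The \<open>k\<close> paths of an integral flow share no slot, and by parity they cannot cross without sharing
  one, so their vertical order never changes. An even column has exactly \<open>k\<close> slots, all of them
  occupied, so the lowest path sits at height 1 in all \<open>k\<close> even columns and has delay \<open>k + 1\<close>.
  A fractional flow can cross: send half a unit along each of the \<open>2 * k\<close> light rays that move
  diagonally and are reflected at heights 0 and \<open>2 * k\<close>. Every slot lies on at most two rays, and
  each ray passes height 1 at most twice, so its delay is at most 3.
\<close>

subsection \<open>Layered digraphs\<close>

text \<open>Vertices and arcs are coded as naturals because the instance is built in the type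
  \<open>(nat, nat) pre_digraph\<close>. An arc code keeps both end heights, so that tail and head
  can be decoded from it.\<close>

definition layer_vertex :: "nat \<Rightarrow> nat \<Rightarrow> nat" where
  "layer_vertex z y = prod_encode (z, y)"

definition layer_arc :: "nat \<Rightarrow> nat \<Rightarrow> nat \<Rightarrow> nat" where
  "layer_arc z y y' = prod_encode (z, prod_encode (y, y'))"

definition layered_digraph ::
  "(nat \<Rightarrow> nat \<Rightarrow> nat \<Rightarrow> bool) \<Rightarrow> nat \<Rightarrow> nat \<Rightarrow> (nat, nat) pre_digraph" where
  "layered_digraph E L B =
     \<lparr>verts = {layer_vertex z y | z y. z \<le> L \<and> y \<le> B},
      arcs = {layer_arc z y y' | z y y'. z < L \<and> y \<le> B \<and> y' \<le> B \<and> E z y y'},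
      tail = (\<lambda>e. case prod_decode e of (z, w) \<Rightarrow> layer_vertex z (fst (prod_decode w))),
      head = (\<lambda>e. case prod_decode e of (z, w) \<Rightarrow> layer_vertex (Suc z) (snd (prod_decode w)))\<rparr>"

definition layer_path :: "nat \<Rightarrow> (nat \<Rightarrow> nat) \<Rightarrow> nat list" where
  "layer_path L Y = map (\<lambda>z. layer_arc z (Y z) (Y (Suc z))) [0..<L]"

lemma layer_vertex_eq_iff [simp]: "layer_vertex z y = layer_vertex z' y' \<longleftrightarrow> z = z' \<and> y = y'"
  by (simp add: layer_vertex_def)

lemma layer_arc_eq_iff [simp]:
  "layer_arc z y y' = layer_arc w x x' \<longleftrightarrow> z = w \<and> y = x \<and> y' = x'"
  by (simp add: layer_arc_def)

lemma tail_layered_digraph [simp]: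
  "tail (layered_digraph E L B) (layer_arc z y y') = layer_vertex z y"
  by (simp add: layered_digraph_def layer_arc_def)

lemma head_layered_digraph [simp]:
  "head (layered_digraph E L B) (layer_arc z y y') = layer_vertex (Suc z) y'"
  by (simp add: layered_digraph_def layer_arc_def)

lemma verts_layered_digraph:
  "verts (layered_digraph E L B) = {layer_vertex z y | z y. z \<le> L \<and> y \<le> B}"
  by (simp add: layered_digraph_def)

lemma arcs_layered_digraph:
  "arcs (layered_digraph E L B) =
     {layer_arc z y y' | z y y'. z < L \<and> y \<le> B \<and> y' \<le> B \<and> E z y y'}"
  by (simp add: layered_digraph_def)

lemma digraph_layered_digraph: "digraph (layered_digraph E L B)"
proof
  have "verts (layered_digraph E L B) = case_prod layer_vertex ` ({..L} \<times> {..B})"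
    by (auto simp: verts_layered_digraph)
  then show "finite (verts (layered_digraph E L B))"
    by simp
  have "arcs (layered_digraph E L B)
      \<subseteq> (\<lambda>(z, y, y'). layer_arc z y y') ` ({..L} \<times> {..B} \<times> {..B})"
    by (auto simp: arcs_layered_digraph image_iff)
  then show "finite (arcs (layered_digraph E L B))"
    by (rule finite_subset) simp
qed (auto simp: arcs_layered_digraph verts_layered_digraph arc_to_ends_def)

lemma set_layer_path: "set (layer_path L Y) = (\<lambda>z. layer_arc z (Y z) (Y (Suc z))) ` {..<L}"
  by (auto simp: layer_path_def)

lemma layer_path_cong:
  "(\<And>z. z \<le> L \<Longrightarrow> Y z = Y' z) \<Longrightarrow> layer_path L Y = layer_path L Y'"
  by (simp add: layer_path_def)

text \<open>\<open>path_delay\<close> sums over a set of arcs; nothing is lost, since the arcs of a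
  layer path leave distinct layers.\<close>

lemma path_delay_layer_path:
  "path_delay d (layer_path L Y) = (\<Sum>z<L. d (layer_arc z (Y z) (Y (Suc z))))"
  unfolding path_delay_def set_layer_path by (subst sum.reindex) (auto simp: inj_on_def)

text \<open>Every arc climbs exactly one layer, so a walk is determined by its height in each layer
  that it visits.\<close>

lemma cas_layered_digraphE:
  assumes "pre_digraph.cas (layered_digraph E L B) (layer_vertex z y) p (layer_vertex w b)"
    and "set p \<subseteq> arcs (layered_digraph E L B)" and "y \<le> B"
  shows "z \<le> w \<and> (\<exists>Y. Y z = y \<and> Y w = b \<and>
           p = map (\<lambda>i. layer_arc i (Y i) (Y (Suc i))) [z..<w] \<and>
           (\<forall>i\<in>{z..<w}. E i (Y i) (Y (Suc i))) \<and> (\<forall>i\<in>{z..w}. Y i \<le> B))"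
  using assms
proof (induction p arbitrary: z y)
  case Nil
  then show ?case
    by (auto simp: pre_digraph.cas.simps intro!: exI[of _ "\<lambda>_. y"])
next
  case (Cons e p)
  from Cons.prems obtain y' where e: "e = layer_arc z y y'" "y' \<le> B" "E z y y'"
    by (auto simp: pre_digraph.cas.simps arcs_layered_digraph)
  have "pre_digraph.cas (layered_digraph E L B) (layer_vertex (Suc z) y') p (layer_vertex w b)"
    using Cons.prems(1) e(1) by (simp add: pre_digraph.cas.simps)
  from Cons.IH[OF this _ e(2)] Cons.prems(2) obtain Y where zw: "Suc z \<le> w" and
    Y: "Y (Suc z) = y'" "Y w = b" "p = map (\<lambda>i. layer_arc i (Y i) (Y (Suc i))) [Suc z..<w]"
       "\<forall>i\<in>{Suc z..<w}. E i (Y i) (Y (Suc i))" "\<forall>i\<in>{Suc z..w}. Y i \<le> B"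
    by (metis set_subset_Cons subset_trans)
  \<comment> \<open>The induction hypothesis fixes heights only from layer \<open>Suc z\<close> on;
    the start height is patched in below.\<close>
  let ?Y = "Y(z := y)"
  have "e # p = map (\<lambda>i. layer_arc i (?Y i) (?Y (Suc i))) [z..<w]"
    using zw e(1) Y(1,3) by (simp add: upt_conv_Cons)
  moreover have "E i (?Y i) (?Y (Suc i))" if "i \<in> {z..<w}" for i
    using that e(3) Y(1,4) by (cases "i = z") auto
  moreover have "?Y i \<le> B" if "i \<in> {z..w}" for i
    using that Cons.prems(3) Y(5) by (cases "i = z") auto
  moreover have "?Y z = y" "?Y w = b" "z \<le> w"
    using zw Y(2) by auto
  ultimately show ?case
    by (intro conjI exI[of _ ?Y] ballI)
qed

text \<open>Conversely, heights yield a walk. Its vertex list is computed as well because simplicity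
  will be read off from it. The induction runs downwards from \<open>w\<close>, as the recursion of
  \<open>cas\<close> peels off the first arc.\<close>

lemma
  assumes "z \<le> w"
  shows cas_layer_walk:
      "pre_digraph.cas (layered_digraph E L B) (layer_vertex z (Y z))
         (map (\<lambda>i. layer_arc i (Y i) (Y (Suc i))) [z..<w]) (layer_vertex w (Y w))"
    and awalk_verts_layer_walk:
      "pre_digraph.awalk_verts (layered_digraph E L B) (layer_vertex z (Y z))
         (map (\<lambda>i. layer_arc i (Y i) (Y (Suc i))) [z..<w])
       = map (\<lambda>i. layer_vertex i (Y i)) [z..<Suc w]"
  using assms
proof (induction rule: inc_induct)
  case base
  {
    case 1
    then show ?case by (simp add: pre_digraph.cas.simps)
  next
    case 2
    then show ?case by (simp add: pre_digraph.awalk_verts.simps)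
  }
next
  case (step n)
  {
    case 1
    with step show ?case by (simp add: pre_digraph.cas.simps upt_conv_Cons)
  next
    case 2
    with step show ?case by (simp add: pre_digraph.awalk_verts.simps upt_conv_Cons)
  }
qed

text \<open>The vertices of a walk lie in distinct layers, so every walk is simple and paths are the
  same as admissible height functions.\<close>

lemma st_paths_layered_digraph:
  assumes "a \<le> B"
  shows "st_paths (layered_digraph E L B) (layer_vertex 0 a) (layer_vertex L b) =
    {layer_path L Y | Y. Y 0 = a \<and> Y L = b \<and> (\<forall>z\<le>L. Y z \<le> B) \<and> (\<forall>z<L. E z (Y z) (Y (Suc z)))}"
    (is "?P = ?Q")
proof (intro equalityI subsetI)
  fix p
  assume "p \<in> ?P"
  then have "pre_digraph.awalk (layered_digraph E L B) (layer_vertex 0 a) p (layer_vertex L b)"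
    by (simp add: st_paths_def pre_digraph.apath_def)
  then have "set p \<subseteq> arcs (layered_digraph E L B)"
    and "pre_digraph.cas (layered_digraph E L B) (layer_vertex 0 a) p (layer_vertex L b)"
    by (auto simp: pre_digraph.awalk_def)
  from cas_layered_digraphE[OF this(2,1) assms] show "p \<in> ?Q"
    by (auto simp: layer_path_def)
next
  fix p
  assume "p \<in> ?Q"
  then obtain Y where Y: "p = layer_path L Y" "Y 0 = a" "Y L = b" "\<forall>z\<le>L. Y z \<le> B"
    "\<forall>z<L. E z (Y z) (Y (Suc z))"
    by auto
  then have "set p \<subseteq> arcs (layered_digraph E L B)"
    by (auto simp: set_layer_path arcs_layered_digraph)
  moreover have "layer_vertex 0 a \<in> verts (layered_digraph E L B)"
    using assms by (auto simp: verts_layered_digraph)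
  ultimately show "p \<in> ?P"
    using cas_layer_walk[of 0 L E L B Y] awalk_verts_layer_walk[of 0 L E L B Y] Y
    by (auto simp: st_paths_def pre_digraph.apath_def pre_digraph.awalk_def layer_path_def
        distinct_map inj_on_def)
qed

subsection \<open>Flows with unit capacities\<close>

lemma finite_st_paths: "digraph G \<Longrightarrow> finite (st_paths G s t)"
  unfolding st_paths_def by (rule fin_digraph.apaths_finite) (simp add: digraph_def)

text \<open>Each index sends \<open>w\<close> units along its path, with multiplicity if paths
  coincide; an arc met by at most \<open>m\<close> indices carries at most
  \<open>w * m\<close>.\<close>

lemma feasible_flow_uniform_family:
  fixes P :: "'i \<Rightarrow> 'b list" and w :: real and m :: nat
  assumes "finite (st_paths G s t)" and "finite I" and "P ` I \<subseteq> st_paths G s t"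
    and "w \<ge> 0" and "w * card I = R" and "w * m \<le> 1"
    and load: "\<And>e. e \<in> arcs G \<Longrightarrow> card {i \<in> I. e \<in> set (P i)} \<le> m"
  shows "feasible_flow G (\<lambda>_. 1) s t R (\<lambda>p. w * card {i \<in> I. P i = p})"
  unfolding feasible_flow_def
proof (intro conjI ballI)
  let ?f = "\<lambda>p. w * card {i \<in> I. P i = p}"
  show "0 \<le> ?f p" for p
    using assms(4) by simp
  \<comment> \<open>Grouping indices by their path turns flow sums into counts of indices; this
    serves both the total rate and the arc loads.\<close>
  have sum_f: "sum ?f A = w * card {i \<in> I. P i \<in> A}" if "finite A" for A
  proof -
    let ?J = "{i \<in> I. P i \<in> A}"
    have "(\<Sum>p\<in>A. \<Sum>i\<in>{i \<in> ?J. P i = p}. 1) = card ?J"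
      using sum.group[of ?J A P "\<lambda>_. 1::nat"] that assms(2) by auto
    moreover have "{i \<in> ?J. P i = p} = {i \<in> I. P i = p}" if "p \<in> A" for p
      using that by auto
    ultimately have "(\<Sum>p\<in>A. card {i \<in> I. P i = p}) = card ?J"
      by simp
    then show ?thesis
      by (simp flip: sum_distrib_left of_nat_sum)
  qed
  have "{i \<in> I. P i \<in> st_paths G s t} = I"
    using assms(3) by auto
  then show "sum ?f (st_paths G s t) = real R"
    using sum_f[OF assms(1)] assms(5) by simp
  fix e
  assume e: "e \<in> arcs G"
  have "{i \<in> I. P i \<in> {p \<in> st_paths G s t. e \<in> set p}} = {i \<in> I. e \<in> set (P i)}"
    using assms(3) by auto
  then have "sum ?f {p \<in> st_paths G s t. e \<in> set p} = w * card {i \<in> I. e \<in> set (P i)}"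
    using sum_f[of "{p \<in> st_paths G s t. e \<in> set p}"] assms(1) by simp
  also have "\<dots> \<le> w * m"
    using load[OF e] assms(4) by (intro mult_left_mono) auto
  finally show "sum ?f {p \<in> st_paths G s t. e \<in> set p} \<le> real 1"
    using assms(6) by simp
qed

lemma max_delay_ge:
  assumes "finite (st_paths G s t)" and "p \<in> st_paths G s t" and "f p > 0"
  shows "path_delay d p \<le> max_delay G d s t f"
  unfolding max_delay_def using assms by (intro Max_ge) auto

lemma feasible_flow_support:
  assumes "feasible_flow G c s t R f" and "R > 0"
  obtains p where "p \<in> st_paths G s t" and "f p > 0"
proof -
  have "\<exists>p\<in>st_paths G s t. f p > 0"
  proof (rule ccontr)
    assume "\<not> ?thesis"
    then have "sum f (st_paths G s t) \<le> 0"
      by (intro sum_nonpos) (auto simp: not_less)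
    then show False
      using assms by (simp add: feasible_flow_def)
  qed
  then show thesis
    using that by auto
qed

text \<open>Feasibility with \<open>R > 0\<close> makes the set under \<open>Max\<close> nonempty;
  otherwise its value would be unspecified.\<close>

lemma max_delay_le:
  assumes "finite (st_paths G s t)" and "feasible_flow G c s t R f" and "R > 0"
    and "\<And>p. p \<in> st_paths G s t \<Longrightarrow> f p > 0 \<Longrightarrow> path_delay d p \<le> D"
  shows "max_delay G d s t f \<le> D"
proof -
  obtain p where "p \<in> st_paths G s t" "f p > 0"
    by (rule feasible_flow_support[OF assms(2,3)])
  then show ?thesis
    unfolding max_delay_def using assms(1,4) by (intro Max.boundedI) auto
qed

text \<open>A positive integral value is at least 1, and the capacity of an arc on the path caps it
  at 1. Hence the support consists of exactly \<open>R\<close> paths, and two of them sharing an arc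
  would load it with 2.\<close>

lemma int_feasible_flow_unit_capacity:
  assumes "finite (st_paths G s t)" and "int_feasible_flow G (\<lambda>_. 1) s t R f"
    and "\<And>p. p \<in> st_paths G s t \<Longrightarrow> set p \<inter> arcs G \<noteq> {}"
  obtains Q where "Q \<subseteq> st_paths G s t" and "card Q = R" and "\<And>p. p \<in> Q \<Longrightarrow> f p > 0"
    and "\<And>p q e. p \<in> Q \<Longrightarrow> q \<in> Q \<Longrightarrow> e \<in> arcs G \<Longrightarrow> e \<in> set p \<Longrightarrow> e \<in> set q \<Longrightarrow> p = q"
proof
  let ?Q = "{p \<in> st_paths G s t. f p > 0}"
  have nonneg: "f p \<ge> 0" and ints: "f p \<in> \<int>" if "p \<in> st_paths G s t" for p
    using assms(2) that by (simp_all add: int_feasible_flow_def feasible_flow_def)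
  have total: "sum f (st_paths G s t) = R"
    using assms(2) by (simp add: int_feasible_flow_def feasible_flow_def)
  have load: "(\<Sum>p\<in>{p \<in> st_paths G s t. e \<in> set p}. f p) \<le> 1" if "e \<in> arcs G" for e
    using assms(2) that by (simp add: int_feasible_flow_def feasible_flow_def)
  have ge1: "f p \<ge> 1" if p: "p \<in> ?Q" for p
  proof -
    obtain n where "f p = of_int n"
      using ints[of p] p by (auto elim: Ints_cases)
    with p show ?thesis by simp
  qed
  have part: "sum f A \<le> 1" if "e \<in> arcs G" "A \<subseteq> {p \<in> st_paths G s t. e \<in> set p}" for e A
  proof -
    have "sum f A \<le> (\<Sum>p\<in>{p \<in> st_paths G s t. e \<in> set p}. f p)"
      using that nonneg assms(1) by (intro sum_mono2) auto
    with load[OF that(1)] show ?thesis by simp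
  qed
  have eq1: "f p = 1" if p: "p \<in> ?Q" for p
  proof -
    obtain e where "e \<in> arcs G" "e \<in> set p"
      using assms(3)[of p] p by blast
    with part[of e "{p}"] ge1[OF p] p show ?thesis by auto
  qed
  have "real R = sum f (st_paths G s t)"
    using total by simp
  also have "\<dots> = sum f ?Q"
    using nonneg assms(1) by (intro sum.mono_neutral_right) (auto simp: less_le)
  also have "\<dots> = (\<Sum>p\<in>?Q. 1)"
    using eq1 by (intro sum.cong) auto
  finally show "card ?Q = R" by simp
  show "p = q" if "p \<in> ?Q" "q \<in> ?Q" "e \<in> arcs G" "e \<in> set p" "e \<in> set q" for p q e
  proof (rule ccontr)
    assume "p \<noteq> q"
    then have "sum f {p, q} = 2"
      using eq1[of p] eq1[of q] that by simp
    with part[of e "{p, q}"] that show False by auto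
  qed
qed auto

text \<open>Delays are naturals, so well-ordering yields optimal flows without any compactness
  argument.\<close>

lemma ex_is_arg_min_nat:
  fixes g :: "'a \<Rightarrow> nat"
  assumes "P x"
  obtains y where "is_arg_min g P y"
proof
  show "is_arg_min g P (arg_min g P)"
    unfolding is_arg_min_linorder
    by (intro conjI allI impI arg_min_natI[of P x] arg_min_nat_le assms)
qed

subsection \<open>The brick wall\<close>

definition slot :: "nat \<Rightarrow> nat \<Rightarrow> nat \<Rightarrow> bool" where
  "slot k x y \<longleftrightarrow> y \<le> 2 * k \<and> odd (x + y)"

text \<open>Slot \<open>(x, y)\<close> is an arc from layer \<open>2 * x + 1\<close> to layer \<open>2 * x + 2\<close>, so that it carries a
  capacity; layer 0 is the source and layer \<open>4 * k - 1\<close> the sink.\<close>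

definition wall_step :: "nat \<Rightarrow> nat \<Rightarrow> nat \<Rightarrow> nat \<Rightarrow> bool" where
  "wall_step k z y y' \<longleftrightarrow>
     (if z = 0 then y = 0 \<and> slot k 0 y'
      else if z = 4 * k - 2 then slot k (2 * k - 2) y \<and> y' = 0
      else if odd z then slot k (z div 2) y \<and> y' = y
      else slot k (z div 2 - 1) y \<and> slot k (z div 2) y' \<and> (y' = Suc y \<or> y = Suc y'))"

definition wall :: "nat \<Rightarrow> (nat, nat) pre_digraph" where
  "wall k = layered_digraph (wall_step k) (4 * k - 1) (2 * k)"

definition wall_source :: nat where
  "wall_source = layer_vertex 0 0"

definition wall_sink :: "nat \<Rightarrow> nat" where
  "wall_sink k = layer_vertex (4 * k - 1) 0"

text \<open>The condition \<open>z mod 4 = 1\<close> says \<open>z = 2 * x + 1\<close> with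
  \<open>x\<close> even, which selects the slot arcs of even columns. The unit on layer 0 keeps
  every delay positive.\<close>

definition wall_delay :: "nat \<Rightarrow> nat" where
  "wall_delay e = (case prod_decode e of (z, w) \<Rightarrow>
     if z = 0 \<or> z mod 4 = 1 \<and> fst (prod_decode w) = 1 then 1 else 0)"

definition wall_walk :: "nat \<Rightarrow> (nat \<Rightarrow> nat) \<Rightarrow> bool" where
  "wall_walk k g \<longleftrightarrow> (\<forall>x < 2 * k - 1. slot k x (g x)) \<and>
     (\<forall>x. Suc x < 2 * k - 1 \<longrightarrow> g (Suc x) = Suc (g x) \<or> g x = Suc (g (Suc x)))"

text \<open>\<open>(z - 1) div 2\<close> sends both layers \<open>2 * x + 1\<close> and
  \<open>2 * x + 2\<close> to column \<open>x\<close>; source and sink have height 0.\<close>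

definition wall_path :: "nat \<Rightarrow> (nat \<Rightarrow> nat) \<Rightarrow> nat list" where
  "wall_path k g =
     layer_path (4 * k - 1) (\<lambda>z. if z = 0 \<or> z = 4 * k - 1 then 0 else g ((z - 1) div 2))"

lemma wall_delay_layer_arc:
  "wall_delay (layer_arc z y y') = (if z = 0 \<or> z mod 4 = 1 \<and> y = 1 then 1 else 0)"
  by (simp add: wall_delay_def layer_arc_def)

lemma min_max_delay_instance_wall:
  assumes "k > 0"
  shows "min_max_delay_instance (wall k) wall_source (wall_sink k) k"
proof -
  interpret digraph "wall k"
    unfolding wall_def by (rule digraph_layered_digraph)
  show ?thesis
    using assms by unfold_locales
      (auto simp: wall_source_def wall_sink_def wall_def verts_layered_digraph)
qed

lemma finite_st_paths_wall: "finite (st_paths (wall k) s t)"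
  unfolding wall_def by (rule finite_st_paths[OF digraph_layered_digraph])

text \<open>Slot arcs keep the height, so the two layers of a column agree and a path amounts to one
  height per column.\<close>

lemma st_paths_wall:
  assumes "k > 0"
  shows "st_paths (wall k) wall_source (wall_sink k) = {wall_path k g | g. wall_walk k g}"
    (is "?P = ?Q")
proof (intro equalityI subsetI)
  fix p
  assume "p \<in> ?P"
  then obtain Y where p: "p = layer_path (4 * k - 1) Y" and ends: "Y 0 = 0" "Y (4 * k - 1) = 0"
    and step: "\<And>z. z < 4 * k - 1 \<Longrightarrow> wall_step k z (Y z) (Y (Suc z))"
    unfolding wall_def wall_source_def wall_sink_def by (auto simp: st_paths_layered_digraph)
  define g where "g x = Y (2 * x + 1)" for x
  have "slot k x (g x) \<and> Y (2 * x + 2) = g x" if "x < 2 * k - 1" for x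
  proof -
    have "2 * x + 1 \<noteq> 4 * k - 2" "2 * x + 1 < 4 * k - 1"
      using that by presburger+
    with step[of "2 * x + 1"] show ?thesis
      by (simp add: wall_step_def g_def)
  qed
  then have slot: "slot k x (g x)" and same: "Y (2 * x + 2) = g x" if "x < 2 * k - 1" for x
    using that by auto
  have "g (Suc x) = Suc (g x) \<or> g x = Suc (g (Suc x))" if "Suc x < 2 * k - 1" for x
  proof -
    have "2 * x + 2 \<noteq> 4 * k - 2" "2 * x + 2 < 4 * k - 1" "Y (2 * x + 2) = g x"
      using that same[of x] by simp_all
    moreover have "Y (Suc (2 * x + 2)) = g (Suc x)"
      by (simp add: g_def)
    ultimately show ?thesis
      using step[of "2 * x + 2"] by (simp add: wall_step_def)
  qed
  with slot have "wall_walk k g"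
    by (simp add: wall_walk_def)
  moreover have "Y z = g ((z - 1) div 2)" if "z \<noteq> 0" "z < 4 * k - 1" for z
  proof (cases "odd z")
    case True
    then show ?thesis
      by (auto simp: g_def elim!: oddE)
  next
    case False
    then have z: "z = 2 * ((z - 1) div 2) + 2"
      using that(1) by presburger
    with that(2) have "(z - 1) div 2 < 2 * k - 1"
      by linarith
    from same[OF this] z show ?thesis by simp
  qed
  ultimately show "p \<in> ?Q"
    using ends unfolding p wall_path_def by (auto intro!: exI[of _ g] layer_path_cong)
next
  fix p
  assume "p \<in> ?Q"
  then obtain g where p: "p = wall_path k g" and g: "wall_walk k g"
    by auto
  let ?Y = "\<lambda>z. if z = 0 \<or> z = 4 * k - 1 then 0 else g ((z - 1) div 2)"
  have slot: "slot k x (g x)" if "x < 2 * k - 1" for x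
    using g that by (simp add: wall_walk_def)
  have bound: "?Y z \<le> 2 * k" if "z \<le> 4 * k - 1" for z
    using slot[of "(z - 1) div 2"] that by (auto simp: slot_def)
  have step: "wall_step k z (?Y z) (?Y (Suc z))" if "z < 4 * k - 1" for z
  proof -
    define x where "x = (z - 1) div 2"
    \<comment> \<open>The four cases are the step out of the source, the step into the sink, passing
      through a slot, and changing the column.\<close>
    have "z = 0 \<or> z = 2 * x + 1 \<or> z = 2 * x + 2"
      unfolding x_def by presburger
    with that have "z = 0 \<or> z = 2 * x + 2 \<and> x = 2 * k - 2 \<or>
        z = 2 * x + 1 \<and> x < 2 * k - 1 \<or> z = 2 * x + 2 \<and> Suc x < 2 * k - 1"
      by linarith
    then consider "z = 0" | "z = 2 * x + 2" "x = 2 * k - 2"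
      | "z = 2 * x + 1" "x < 2 * k - 1" | "z = 2 * x + 2" "Suc x < 2 * k - 1"
      by blast
    then show ?thesis
    proof cases
      case 1
      moreover have "Suc 0 \<noteq> 4 * k - 1"
        by presburger
      ultimately show ?thesis
        using slot[of 0] assms by (simp add: wall_step_def)
    next
      case 2
      then have "z = 4 * k - 2" "Suc z = 4 * k - 1" "?Y z = g (2 * k - 2)"
        using assms by auto
      with 2 slot[of "2 * k - 2"] assms show ?thesis by (simp add: wall_step_def)
    next
      case 3
      then have "?Y z = g x" "?Y (Suc z) = g x" by auto
      moreover have "z \<noteq> 4 * k - 2" "z \<noteq> 0" "odd z" "z div 2 = x"
        using 3 by presburger+
      ultimately show ?thesis
        using slot[of x] 3 by (simp add: wall_step_def)
    next
      case 4
      then have "?Y z = g x" "?Y (Suc z) = g (Suc x)" by auto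
      moreover have "z \<noteq> 4 * k - 2" "z \<noteq> 0" using 4 by auto
      ultimately show ?thesis
        using slot[of x] slot[of "Suc x"] g 4 by (simp add: wall_step_def wall_walk_def)
    qed
  qed
  show "p \<in> ?P"
    unfolding wall_def wall_source_def wall_sink_def p wall_path_def
    using bound step by (subst st_paths_layered_digraph) (auto intro!: exI[of _ ?Y])
qed

text \<open>Through these arcs the unit arc capacities act as capacities on slots.\<close>

lemma slot_arc_in_wall_path:
  assumes "x < 2 * k - 1"
  shows "layer_arc (2 * x + 1) (g x) (g x) \<in> set (wall_path k g)"
  unfolding wall_path_def set_layer_path using assms
  by (intro image_eqI[where x = "2 * x + 1"]) auto

lemma slot_arc_in_wall:
  assumes "wall_walk k g" and "x < 2 * k - 1"
  shows "layer_arc (2 * x + 1) (g x) (g x) \<in> arcs (wall k)"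
proof -
  have "slot k x (g x)"
    using assms by (simp add: wall_walk_def)
  moreover have "2 * x + 1 \<noteq> 4 * k - 2"
    by presburger
  ultimately show ?thesis
    using assms(2) by (auto simp: wall_def arcs_layered_digraph wall_step_def slot_def)
qed

text \<open>All paths through an arc share a slot: the one at its head if it leaves the source, the
  one at its tail otherwise. Bounding slot loads therefore bounds all arc loads.\<close>

lemma wall_arc_determines_slot:
  assumes "k > 0" and "e \<in> arcs (wall k)"
  obtains x y where "x < 2 * k - 1" and "\<And>g. e \<in> set (wall_path k g) \<Longrightarrow> g x = y"
proof -
  obtain z y y' where e: "e = layer_arc z y y'" "z < 4 * k - 1"
    using assms(2) by (auto simp: wall_def arcs_layered_digraph)
  show thesis
  proof (cases "z = 0")
    case True
    with e assms(1) show thesis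
      by (intro that[of 0 y']) (auto simp: wall_path_def set_layer_path)
  next
    case False
    with e show thesis
      by (intro that[of "(z - 1) div 2" y]) (auto simp: wall_path_def set_layer_path)
  qed
qed

text \<open>The \<open>Suc\<close> is the unit paid on leaving the source.\<close>

lemma path_delay_wall_path:
  assumes "k > 0"
  shows "path_delay wall_delay (wall_path k g) = Suc (card {x. x < 2 * k - 1 \<and> even x \<and> g x = 1})"
proof -
  let ?Y = "\<lambda>z. if z = 0 \<or> z = 4 * k - 1 then 0 else g ((z - 1) div 2)"
  let ?X = "{x. x < 2 * k - 1 \<and> even x \<and> g x = 1}"
  have "path_delay wall_delay (wall_path k g)
      = card {z \<in> {..<4 * k - 1}. z = 0 \<or> z mod 4 = 1 \<and> ?Y z = 1}"
    unfolding wall_path_def path_delay_layer_path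
    by (simp only: wall_delay_layer_arc card_eq_sum sum.inter_filter finite_lessThan)
  also have "{z \<in> {..<4 * k - 1}. z = 0 \<or> z mod 4 = 1 \<and> ?Y z = 1}
      = insert 0 ((\<lambda>x. 2 * x + 1) ` ?X)" (is "?A = ?B")
  proof (intro equalityI subsetI)
    fix z
    assume z: "z \<in> ?A"
    show "z \<in> ?B"
    proof (cases "z = 0")
      case False
      then have "z mod 4 = 1" using z by auto
      then have "z = 2 * ((z - 1) div 2) + 1" "even ((z - 1) div 2)"
        by presburger+
      with z False show ?thesis
        by (intro insertI2 image_eqI[where x = "(z - 1) div 2"]) (auto split: if_splits)
    qed simp
  next
    fix z
    assume "z \<in> ?B"
    then show "z \<in> ?A"
      using assms by (auto elim!: evenE)
  qed
  also have "card (insert 0 ((\<lambda>x. 2 * x + 1) ` ?X)) = Suc (card ?X)"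
    by (subst card_insert_disjoint) (auto simp: card_image inj_on_def)
  finally show ?thesis .
qed

lemma feasible_flow_wall:
  fixes g :: "'i \<Rightarrow> nat \<Rightarrow> nat" and w :: real and m :: nat
  assumes "k > 0" and "finite I" and "\<And>i. i \<in> I \<Longrightarrow> wall_walk k (g i)"
    and "w \<ge> 0" and "w * card I = k" and "w * m \<le> 1"
    and load: "\<And>x y. x < 2 * k - 1 \<Longrightarrow> card {i \<in> I. g i x = y} \<le> m"
  shows "feasible_flow (wall k) (\<lambda>_. 1) wall_source (wall_sink k) k
           (\<lambda>p. w * card {i \<in> I. wall_path k (g i) = p})"
proof (rule feasible_flow_uniform_family[where m = m])
  fix e
  assume "e \<in> arcs (wall k)"
  then obtain x y where xy: "x < 2 * k - 1" "\<And>h. e \<in> set (wall_path k h) \<Longrightarrow> h x = y"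
    using wall_arc_determines_slot[OF assms(1)] by metis
  have "card {i \<in> I. e \<in> set (wall_path k (g i))} \<le> card {i \<in> I. g i x = y}"
    using assms(2) xy(2) by (intro card_mono) auto
  with load[OF xy(1)] show "card {i \<in> I. e \<in> set (wall_path k (g i))} \<le> m"
    using le_trans by blast
next
  show "finite (st_paths (wall k) wall_source (wall_sink k))"
    by (rule finite_st_paths_wall)
  show "(\<lambda>i. wall_path k (g i)) ` I \<subseteq> st_paths (wall k) wall_source (wall_sink k)"
    using assms(1,3) by (auto simp: st_paths_wall)
qed (fact assms)+

subsection \<open>Integral and fractional flows in the brick wall\<close>

definition lane :: "nat \<Rightarrow> nat \<Rightarrow> nat" where
  "lane j x = (if even x then 2 * j + 1 else 2 * j)"

lemma ex_int_feasible_flow_wall: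
  assumes "k > 0"
  shows "\<exists>f. int_feasible_flow (wall k) (\<lambda>_. 1) wall_source (wall_sink k) k f"
proof -
  have "card {j \<in> {..<k}. lane j x = y} \<le> 1" for x y
  proof -
    \<comment> \<open>Lane \<open>j\<close> alternates between the heights \<open>2 * j\<close> and
      \<open>2 * j + 1\<close>, so a height determines its lane.\<close>
    have "{j \<in> {..<k}. lane j x = y} \<subseteq> {y div 2}"
      by (auto simp: lane_def)
    then show ?thesis
      using card_mono[of "{y div 2}"] by simp
  qed
  moreover have "wall_walk k (lane j)" if "j < k" for j
    using that by (auto simp: wall_walk_def slot_def lane_def)
  ultimately have "feasible_flow (wall k) (\<lambda>_. 1) wall_source (wall_sink k) k
      (\<lambda>p. 1 * real (card {j \<in> {..<k}. wall_path k (lane j) = p}))"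
    using assms by (intro feasible_flow_wall[where m = 1]) auto
  then show ?thesis
    by (auto simp: int_feasible_flow_def)
qed

text \<open>The height of a ray, a triangle wave of period \<open>4 * k\<close>.\<close>

definition zigzag :: "nat \<Rightarrow> nat \<Rightarrow> nat" where
  "zigzag k z = (let r = z mod (4 * k) in if r \<le> 2 * k then 2 * k - r else r - 2 * k)"

section \<open>Reflected rays: a fractional flow of bounded delay\<close>

lemma zigzag_le:
  assumes "k > 0"
  shows "zigzag k z \<le> 2 * k"
proof -
  define r where "r = z mod (4 * k)"
  have "r < 4 * k"
    using assms by (simp add: r_def)
  then show ?thesis
    by (auto simp: zigzag_def simp flip: r_def)
qed

lemma even_zigzag: "even (zigzag k z) \<longleftrightarrow> even z"
proof -
  have "even (z mod (4 * k)) \<longleftrightarrow> even z"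
    by (intro dvd_mod_iff) simp
  then show ?thesis
    by (auto simp: zigzag_def Let_def)
qed

lemma zigzag_Suc:
  assumes "k > 0"
  shows "zigzag k (Suc z) = Suc (zigzag k z) \<or> zigzag k z = Suc (zigzag k (Suc z))"
proof -
  define r where "r = z mod (4 * k)"
  have "r < 4 * k"
    using assms by (simp add: r_def)
  have Suc_mod: "Suc z mod (4 * k) = (if Suc r = 4 * k then 0 else Suc r)"
    by (simp add: mod_Suc r_def)
  \<comment> \<open>These are the wrap-around at the end of the period, the falling half and the
    rising half.\<close>
  consider "Suc r = 4 * k" "2 * k < r" | "Suc r \<le> 2 * k" | "2 * k \<le> r" "Suc r < 4 * k"
    using \<open>r < 4 * k\<close> assms by linarith
  then show ?thesis
    using assms by cases (auto simp: zigzag_def Let_def Suc_mod simp flip: r_def)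
qed

lemma inj_on_add_mod_nat: "inj_on (\<lambda>i::nat. (a + i) mod n) {..<n}"
proof (rule linorder_inj_onI)
  fix i j :: nat
  assume "i < j" "j \<in> {..<n}"
  show "(a + i) mod n \<noteq> (a + j) mod n"
  proof
    assume "(a + i) mod n = (a + j) mod n"
    then have "n dvd (a + j) - (a + i)"
      using \<open>i < j\<close> by (subst (asm) eq_commute) (simp add: mod_eq_dvd_iff_nat)
    with \<open>i < j\<close> \<open>j \<in> {..<n}\<close> show False
      by (auto dest: dvd_imp_le)
  qed
qed auto

text \<open>Within one period the wave takes the value \<open>y\<close> at most at the residues
  \<open>2 * k - y\<close> and \<open>2 * k + y\<close>. This bounds both the rays through a slot
  (\<open>i\<close> varies over rays) and the visits of one ray to a height (\<open>i\<close> varies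
  over columns).\<close>

lemma card_zigzag_level:
  assumes "inj_on h I" and "h ` I \<subseteq> {..<4 * k}"
  shows "card {i \<in> I. zigzag k (a + h i) = y} \<le> 2"
proof -
  let ?h = "\<lambda>i. (a + h i) mod (4 * k)"
  let ?J = "{i \<in> I. zigzag k (a + h i) = y}"
  have "inj_on ?h ?J"
    using assms inj_on_add_mod_nat[of a "4 * k"] unfolding inj_on_def by (auto simp: image_subset_iff)
  moreover have "?h ` ?J \<subseteq> {2 * k - y, 2 * k + y}"
    by (auto simp: zigzag_def Let_def split: if_splits)
  ultimately have "card ?J \<le> card {2 * k - y, 2 * k + y}"
    by (intro card_inj_on_le) auto
  also have "\<dots> \<le> 2"
    by (simp add: card_insert_if)
  finally show ?thesis .
qed

lemma ex_feasible_flow_wall_delay_le: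
  assumes "k > 0"
  shows "\<exists>f. feasible_flow (wall k) (\<lambda>_. 1) wall_source (wall_sink k) k f \<and>
             max_delay (wall k) wall_delay wall_source (wall_sink k) f \<le> 3"
proof -
  \<comment> \<open>Odd phases give the rays the parity of slots, and one period
    \<open>4 * k\<close> contains exactly \<open>2 * k\<close> of them.\<close>
  define ray where "ray i x = zigzag k (x + (2 * i + 1))" for i x
  let ?f = "\<lambda>p. 1 / 2 * real (card {i \<in> {..<2 * k}. wall_path k (ray i) = p})"
  have "card {i \<in> {..<2 * k}. ray i x = y} \<le> 2" for x y
    unfolding ray_def by (intro card_zigzag_level) (auto simp: inj_on_def)
  moreover have "wall_walk k (ray i)" for i
    using assms zigzag_Suc[OF assms]
    by (auto simp: wall_walk_def slot_def ray_def zigzag_le even_zigzag)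
  ultimately have feas: "feasible_flow (wall k) (\<lambda>_. 1) wall_source (wall_sink k) k ?f"
    using assms by (intro feasible_flow_wall[where m = 2]) auto
  have "path_delay wall_delay p \<le> 3" if "?f p > 0" for p
  proof -
    obtain i where p: "p = wall_path k (ray i)"
    proof (rule ccontr)
      assume "\<not> thesis"
      then have "{i \<in> {..<2 * k}. wall_path k (ray i) = p} = {}"
        using that by blast
      then have "?f p = 0"
        by (simp only: card.empty)
      with \<open>?f p > 0\<close> show False by linarith
    qed
    \<comment> \<open>Visits to height 1 are counted over all columns; they number at most 2, and
      the source arc makes 3.\<close>
    have "card {x. x < 2 * k - 1 \<and> even x \<and> ray i x = 1}
        \<le> card {x \<in> {..<2 * k - 1}. zigzag k ((2 * i + 1) + x) = 1}"
      unfolding ray_def by (intro card_mono) (auto simp: add.commute)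
    also have "\<dots> \<le> 2"
      using card_zigzag_level[of "\<lambda>x. x" "{..<2 * k - 1}" k "2 * i + 1" 1] by auto
    finally show ?thesis
      by (simp add: p path_delay_wall_path[OF assms])
  qed
  with max_delay_le[OF finite_st_paths_wall feas assms] feas show ?thesis
    by blast
qed

lemma max_delay_wall_pos:
  assumes "k > 0" and "feasible_flow (wall k) c wall_source (wall_sink k) k f"
  shows "max_delay (wall k) wall_delay wall_source (wall_sink k) f > 0"
proof -
  obtain p where p: "p \<in> st_paths (wall k) wall_source (wall_sink k)" "f p > 0"
    by (rule feasible_flow_support[OF assms(2,1)])
  then have "path_delay wall_delay p > 0"
    using assms(1) by (auto simp: st_paths_wall path_delay_wall_path)
  with max_delay_ge[of _ _ _ p f wall_delay, OF finite_st_paths_wall p] show ?thesis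
    by linarith
qed

section \<open>Non-crossing walks: the lower bound for integral flows\<close>

text \<open>By parity, distinct heights in a column differ by at least 2. One step narrows the gap
  by at most 2, so an exchange of order would require a common slot first.\<close>

lemma wall_walk_order:
  assumes "wall_walk k g" and "wall_walk k h" and "\<And>x. x < 2 * k - 1 \<Longrightarrow> g x \<noteq> h x"
    and "g 0 < h 0" and "x < 2 * k - 1"
  shows "g x < h x"
  using assms(5)
proof (induction x)
  case 0
  show ?case by (rule assms(4))
next
  case (Suc x)
  then have less: "g x < h x" and ne: "g (Suc x) \<noteq> h (Suc x)"
    using assms(3) by auto
  have "odd (x + g x)" "odd (x + h x)"
    using assms(1,2) Suc.prems by (auto simp: wall_walk_def slot_def)
  with less have "g x + 2 \<le> h x"
    by presburger
  moreover have "g (Suc x) \<le> Suc (g x)" "h x \<le> Suc (h (Suc x))"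
    using assms(1,2) Suc.prems unfolding wall_walk_def by (metis le_Suc_eq order_refl le_SucI)+
  ultimately show ?case
    using ne by linarith
qed

lemma int_feasible_flow_wall_delay_gt:
  assumes "k > 0" and f: "int_feasible_flow (wall k) (\<lambda>_. 1) wall_source (wall_sink k) k f"
  shows "k < max_delay (wall k) wall_delay wall_source (wall_sink k) f"
proof -
  let ?P = "st_paths (wall k) wall_source (wall_sink k)"
  have "set p \<inter> arcs (wall k) \<noteq> {}" if p: "p \<in> ?P" for p
  proof -
    obtain g where "p = wall_path k g" "wall_walk k g"
      using p assms(1) by (auto simp: st_paths_wall)
    with slot_arc_in_wall_path[of 0 k g] slot_arc_in_wall[of k g 0] assms(1) show ?thesis
      by auto
  qed
  then obtain Q where Q: "Q \<subseteq> ?P" "card Q = k" "\<And>p. p \<in> Q \<Longrightarrow> f p > 0"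
    and disj: "\<And>p q e. p \<in> Q \<Longrightarrow> q \<in> Q \<Longrightarrow> e \<in> arcs (wall k) \<Longrightarrow> e \<in> set p \<Longrightarrow> e \<in> set q \<Longrightarrow> p = q"
    using int_feasible_flow_unit_capacity[OF finite_st_paths_wall f] by metis
  have "\<forall>p\<in>Q. \<exists>g. wall_walk k g \<and> p = wall_path k g"
    using Q(1) assms(1) by (auto simp: st_paths_wall)
  then obtain g where walk: "\<And>p. p \<in> Q \<Longrightarrow> wall_walk k (g p)"
    and path: "\<And>p. p \<in> Q \<Longrightarrow> p = wall_path k (g p)"
    by metis
  \<comment> \<open>Two paths in the same slot share its arc, which has capacity 1.\<close>
  have inj: "p = q" if "p \<in> Q" "q \<in> Q" "x < 2 * k - 1" "g p x = g q x" for p q x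
    using that disj[of p q "layer_arc (2 * x + 1) (g p x) (g p x)"]
      slot_arc_in_wall[OF walk[OF that(1)] that(3)]
      slot_arc_in_wall_path[OF that(3), of "g p"] slot_arc_in_wall_path[OF that(3), of "g q"]
      path[OF that(1)] path[OF that(2)] by simp
  have slot: "slot k x (g p x)" if "p \<in> Q" "x < 2 * k - 1" for p x
    using walk[OF that(1)] that(2) by (simp add: wall_walk_def)
  \<comment> \<open>An even column has exactly the \<open>k\<close> odd heights below
    \<open>2 * k\<close>, and the \<open>k\<close> paths occupy distinct ones, so none is
    free.\<close>
  have onto: "\<exists>p\<in>Q. g p x = 1" if x: "x < 2 * k - 1" "even x" for x
  proof -
    have odds: "{y. y \<le> 2 * k \<and> odd y} = (\<lambda>j. 2 * j + 1) ` {..<k}"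
      by (auto elim!: oddE)
    have "(\<lambda>p. g p x) ` Q \<subseteq> {y. y \<le> 2 * k \<and> odd y}"
      using slot x by (auto simp: slot_def)
    moreover have "card ((\<lambda>p. g p x) ` Q) = k"
      using inj x(1) Q(2) by (subst card_image) (auto simp: inj_on_def)
    moreover have "card {y. y \<le> 2 * k \<and> odd y} = k"
      unfolding odds by (subst card_image) (auto simp: inj_on_def)
    ultimately have "(\<lambda>p. g p x) ` Q = {y. y \<le> 2 * k \<and> odd y}"
      by (intro card_subset_eq) (auto simp: odds)
    moreover have "1 \<in> {y. y \<le> 2 * k \<and> odd y}"
      using assms(1) by simp
    ultimately have "1 \<in> (\<lambda>p. g p x) ` Q"
      by (rule ssubst)
    then show ?thesis
      by (metis imageE)
  qed
  obtain p where p: "p \<in> Q" "g p 0 = 1"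
    using onto[of 0] assms(1) by auto
  have bottom: "g p x = 1" if x: "x < 2 * k - 1" "even x" for x
  proof -
    obtain q where q: "q \<in> Q" "g q x = 1"
      using onto x by blast
    have "q = p"
    proof (rule ccontr)
      \<comment> \<open>In column 0 the path \<open>p\<close> has height 1, so \<open>q\<close>
        starts above it and stays above. In column \<open>x\<close> this puts \<open>p\<close> below
        height 1, hence at 0, which is not a slot of an even column.\<close>
      assume "q \<noteq> p"
      then have ne: "g p x \<noteq> g q x" if "x < 2 * k - 1" for x
        using inj p(1) q(1) that by metis
      have "odd (g q 0)"
        using slot[OF q(1), of 0] assms(1) by (simp add: slot_def)
      then have "g p 0 < g q 0"
        using ne[of 0] p(2) assms(1) by (cases "g q 0") auto
      then have "g p x < g q x"
        using wall_walk_order[OF walk[OF p(1)] walk[OF q(1)]] ne x(1) by blast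
      then show False
        using slot[OF p(1) x(1)] q(2) x(2) by (simp add: slot_def)
    qed
    with q show ?thesis by simp
  qed
  \<comment> \<open>The even columns are \<open>0, 2, ..., 2 * k - 2\<close>, which are
    \<open>k\<close> in number.\<close>
  have "{x. x < 2 * k - 1 \<and> even x \<and> g p x = 1} = (\<lambda>j. 2 * j) ` {..<k}"
    using bottom by (auto elim!: evenE)
  then have "card {x. x < 2 * k - 1 \<and> even x \<and> g p x = 1} = k"
    by (simp add: card_image inj_on_def)
  then have "path_delay wall_delay p = Suc k"
    using path_delay_wall_path[OF assms(1), of "g p"] path[OF p(1)] by simp
  moreover have "path_delay wall_delay p \<le> max_delay (wall k) wall_delay wall_source (wall_sink k) f"
    using p(1) Q(1,3) by (intro max_delay_ge finite_st_paths_wall) auto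
  ultimately show ?thesis by simp
qed

theorem theorem5:
  fixes M :: real
  assumes "M > 0"
  shows "\<exists>(G :: (nat, nat) pre_digraph) (c :: nat \<Rightarrow> nat) (d :: nat \<Rightarrow> nat) s t R.
           min_max_delay_instance G s t R \<and>
           (\<exists>f. feasible_flow G c s t R f) \<and>
           (\<exists>f. int_feasible_flow G c s t R f) \<and>
           (\<exists>f_MM f_IMM.
              min_max_delay_optimal G c d s t R f_MM \<and>
              int_min_max_delay_optimal G c d s t R f_IMM \<and>
              real (max_delay G d s t f_IMM) / real (max_delay G d s t f_MM) \<ge> M)"
proof -
  \<comment> \<open>The gap is at least \<open>(k + 1) / 3\<close>, so \<open>k > 3 * M\<close>
    suffices.\<close>
  obtain k :: nat where k: "3 * M < k"
    using reals_Archimedean2 by blast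
  with assms have "k > 0"
    by (cases k) auto
  let ?G = "wall k" and ?c = "\<lambda>_::nat. 1::nat" and ?s = wall_source and ?t = "wall_sink k"
  let ?D = "max_delay ?G wall_delay ?s ?t"
  obtain f where f: "feasible_flow ?G ?c ?s ?t k f" "?D f \<le> 3"
    using ex_feasible_flow_wall_delay_le[OF \<open>k > 0\<close>] by blast
  obtain h where h: "int_feasible_flow ?G ?c ?s ?t k h"
    using ex_int_feasible_flow_wall[OF \<open>k > 0\<close>] by blast
  obtain f' where f': "min_max_delay_optimal ?G ?c wall_delay ?s ?t k f'"
    unfolding min_max_delay_optimal_def
    using ex_is_arg_min_nat[of "feasible_flow ?G ?c ?s ?t k", OF f(1)] .
  obtain h' where h': "int_min_max_delay_optimal ?G ?c wall_delay ?s ?t k h'"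
    unfolding int_min_max_delay_optimal_def
    using ex_is_arg_min_nat[of "int_feasible_flow ?G ?c ?s ?t k", OF h] .
  have "feasible_flow ?G ?c ?s ?t k f'" "?D f' \<le> ?D f"
    using f' f(1) by (auto simp: min_max_delay_optimal_def is_arg_min_linorder)
  \<comment> \<open>Positivity matters because division by zero would yield 0.\<close>
  with f(2) have D: "0 < ?D f'" "?D f' \<le> 3"
    using max_delay_wall_pos[OF \<open>k > 0\<close>] by auto
  have "k < ?D h'"
    using h' int_feasible_flow_wall_delay_gt[OF \<open>k > 0\<close>]
    by (simp add: int_min_max_delay_optimal_def is_arg_min_linorder)
  have "M * ?D f' \<le> M * 3"
    using D(2) assms by (intro mult_left_mono) auto
  also have "\<dots> \<le> ?D h'"
    using k \<open>k < ?D h'\<close> by linarith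
  finally have "M \<le> real (?D h') / real (?D f')"
    using D(1) by (simp add: field_simps)
  with min_max_delay_instance_wall[OF \<open>k > 0\<close>] f(1) h f' h' show ?thesis
    by blast
qed

end
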